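(* Let $\mathcal{H}$ be a complex Hilbert space, $x,y\in\mathcal{H}$ and $T\in\mathcal{B}(\mathcal{H})$, and suppose that $x\otimes y$ majorizes $T$. Then for $S\in\mathcal{B}(\mathcal{H})$ the following are equivalent: (i) $S\in\mathcal{D}_T$; (ii) $h\otimes y$ majorizes $h\otimes S^*y$ for some $h\in\mathcal{H}$; (iii) there exists $M>0$ such that $|\langle z,S^*y\rangle|\le M|\langle z,y\rangle|$ for all $z\in\mathcal{H}$. Also, $$\mathcal{B}_T=\{S\in\mathcal{B}(\mathcal{H}): y\text{ is an eigenvector for }S^*\}=\mathcal{B}_{x\otimes y}.$$
   Context: $\mathcal{B}(\mathcal{H})$ is the algebra of all bounded linear operators on $\mathcal{H}$. For $x,y\in\mathcal{H}$, $x\otimes y\in\mathcal{B}(\mathcal{H})$ is the operator $(x\otimes y)h=\langle h,y\rangle x$. For $T,S\in\mathcal{B}(\mathcal{H})$, $T$ majorizes $S$ if there is $M>0$ with $\|Sx\|\le M\|Tx\|$ for all $x\in\mathcal{H}$. For $T\in\mathcal{B}(\mathcal{H})$ the Deddens algebra $\mathcal{D}_T$ is the set of all $S\in\mathcal{B}(\mathcal{H})$ for which there is $M>0$ with $\|T^nSx\|\le M\|T^nx\|$ for all $n\in\mathbb{N}$ and $x\in\mathcal{H}$. Let $r(T)$ be the spectral radius of $T$; for integers $m\ge1$ put $d_m=\frac{1}{1/m+r(T)}$ and $R_m=\left(\sum_{n=0}^{\infty}d_m^{2n}T^{*n}T^n\right)^{1/2}$ (the series converges in norm and $R_m$ is positive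 and invertible). The spectral radius algebra $\mathcal{B}_T$ is the set of all $S\in\mathcal{B}(\mathcal{H})$ with $\sup_{m\in\mathbb{N}}\|R_mSR_m^{-1}\|<\infty$.
   Formalization: T is assumed nonzero (for T = 0, y ≠ 0 and dim H ≥ 2 one has D_T = B_T = B(H), so the claim fails), and h in (ii) is required to be nonzero (h = 0 would make (ii) hold for every S). *)

theory Defs
  imports "HOL-Analysis.Analysis"
begin

text \<open>
  Complex Hilbert spaces as a type class on top of the real normed spaces of the library. The
  inner product is linear in its first argument. Positive definiteness is contained in
  \<open>norm_eq_sqrt_cinner\<close>, since \<open>norm x\<close> is nonnegative and vanishes only for \<open>x = 0\<close>
  (and \<open>sqrt\<close> of a negative real is negative).
\<close>

class complex_inner = real_normed_vector +
  fixes scaleC :: "complex \<Rightarrow> 'a \<Rightarrow> 'a"  (infixr \<open>*\<^sub>C\<close> 75)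
    and cinner :: "'a \<Rightarrow> 'a \<Rightarrow> complex"
  assumes scaleC_add_right: "scaleC a (x + y) = scaleC a x + scaleC a y"
    and scaleC_add_left: "scaleC (a + b) x = scaleC a x + scaleC b x"
    and scaleC_scaleC: "scaleC a (scaleC b x) = scaleC (a * b) x"
    and scaleR_scaleC: "scaleR r x = scaleC (complex_of_real r) x"
    and cinner_commute: "cinner x y = cnj (cinner y x)"
    and cinner_add_left: "cinner (x + y) z = cinner x z + cinner y z"
    and cinner_scaleC_left: "cinner (scaleC a x) y = a * cinner x y"
    and norm_eq_sqrt_cinner: "norm x = sqrt (Re (cinner x x))"

class chilbert_space = complex_inner + complete_space

lemma cinner_self: "cinner x x = complex_of_real ((norm x)\<^sup>2)"
  for x :: "'a::complex_inner"
proof -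
  have "Im (cinner x x) = 0"
    using cinner_commute[of x x] by (metis complex_cnj_cancel_iff cnj.sel(2) neg_equal_zero)
  moreover have "0 \<le> Re (cinner x x)"
    using norm_ge_zero[of x] unfolding norm_eq_sqrt_cinner by simp
  ultimately show ?thesis
    by (simp add: norm_eq_sqrt_cinner complex_eq_iff)
qed

lemma cinner_add_right: "cinner x (y + z) = cinner x y + cinner x z"
  for x :: "'a::complex_inner"
  by (metis cinner_add_left cinner_commute complex_cnj_add)

lemma cinner_scaleC_right: "cinner x (a *\<^sub>C y) = cnj a * cinner x y"
  for x :: "'a::complex_inner"
  by (metis cinner_scaleC_left cinner_commute complex_cnj_mult)

lemma norm_scaleC: "norm (a *\<^sub>C x) = cmod a * norm x"
  for x :: "'a::complex_inner"
proof -
  have "complex_of_real ((norm (a *\<^sub>C x))\<^sup>2) = a * cnj a * complex_of_real ((norm x)\<^sup>2)"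
    by (simp only: cinner_self[symmetric] cinner_scaleC_left cinner_scaleC_right mult_ac)
  also have "\<dots> = complex_of_real ((cmod a * norm x)\<^sup>2)"
    by (simp add: complex_norm_square[symmetric] power_mult_distrib)
  finally have "(norm (a *\<^sub>C x))\<^sup>2 = (cmod a * norm x)\<^sup>2"
    using of_real_eq_iff by blast
  then show ?thesis by (simp add: power2_eq_iff_nonneg)
qed

lemma complex_Cauchy_Schwarz: "cmod (cinner x y) \<le> norm x * norm y"
  for x :: "'a::complex_inner"
proof (cases "y = 0")
  case True
  have "cinner x 0 = 0" using cinner_add_right[of x 0 0] by simp
  then show ?thesis using True by simp
next
  case False
  define c where "c = cinner x y"
  define n where "n = (norm y)\<^sup>2"
  have n: "n > 0" using False by (simp add: n_def)
  define v where "v = (complex_of_real n) *\<^sub>C x + (- c) *\<^sub>C y"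
  have yx: "cinner y x = cnj c" unfolding c_def by (rule cinner_commute)
  have "complex_of_real ((norm v)\<^sup>2)
      = complex_of_real n * complex_of_real n * complex_of_real ((norm x)\<^sup>2)
        - complex_of_real n * (c * cnj c)"
    unfolding cinner_self[symmetric] v_def cinner_add_left cinner_add_right
      cinner_scaleC_left cinner_scaleC_right yx
    by (simp add: cinner_self n_def[symmetric] c_def[symmetric] algebra_simps)
  also have "\<dots> = complex_of_real (n * (n * (norm x)\<^sup>2 - (cmod c)\<^sup>2))"
    by (simp add: complex_norm_square[symmetric] algebra_simps)
  finally have "(norm v)\<^sup>2 = n * (n * (norm x)\<^sup>2 - (cmod c)\<^sup>2)"
    using of_real_eq_iff by blast
  then have "0 \<le> n * (n * (norm x)\<^sup>2 - (cmod c)\<^sup>2)"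
    by (metis zero_le_power2)
  then have "(cmod c)\<^sup>2 \<le> (norm x * norm y)\<^sup>2"
    using n by (simp add: zero_le_mult_iff n_def power_mult_distrib mult.commute)
  then show ?thesis
    unfolding c_def by (rule power2_le_imp_le) simp
qed

text \<open>
  The library type \<open>'a \<Rightarrow>\<^sub>L 'a\<close> consists of the real-linear bounded operators with the operator
  norm; \<open>\<B>(\<H>)\<close> is its closed subspace of complex-linear operators.
\<close>

definition bounded_ops :: "('a::complex_inner \<Rightarrow>\<^sub>L 'a) set" where
  "bounded_ops = {A. \<forall>c x. blinfun_apply A (c *\<^sub>C x) = c *\<^sub>C blinfun_apply A x}"

lift_definition rank_one :: "'a::complex_inner \<Rightarrow> 'a \<Rightarrow> ('a \<Rightarrow>\<^sub>L 'a)"  (infixl \<open>\<otimes>\<close> 70)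
  is "\<lambda>x y h. cinner h y *\<^sub>C x"
proof (rule bounded_linear_intro)
  fix x y h k :: 'a and r :: real
  show "cinner (h + k) y *\<^sub>C x = cinner h y *\<^sub>C x + cinner k y *\<^sub>C x"
    by (simp add: cinner_add_left scaleC_add_left)
  show "cinner (r *\<^sub>R h) y *\<^sub>C x = r *\<^sub>R (cinner h y *\<^sub>C x)"
    by (simp add: scaleR_scaleC cinner_scaleC_left scaleC_scaleC)
  show "norm (cinner h y *\<^sub>C x) \<le> norm h * (norm y * norm x)"
    using mult_right_mono[OF complex_Cauchy_Schwarz[of h y] norm_ge_zero[of x]]
    by (simp add: norm_scaleC mult.assoc)
qed

definition adjoint_op :: "('a::chilbert_space \<Rightarrow>\<^sub>L 'a) \<Rightarrow> ('a \<Rightarrow>\<^sub>L 'a)" where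
  "adjoint_op A = (THE B. B \<in> bounded_ops \<and>
     (\<forall>x y. cinner (blinfun_apply A x) y = cinner x (blinfun_apply B y)))"

primrec op_power :: "('a::real_normed_vector \<Rightarrow>\<^sub>L 'a) \<Rightarrow> nat \<Rightarrow> ('a \<Rightarrow>\<^sub>L 'a)" where
  "op_power A 0 = id_blinfun"
| "op_power A (Suc n) = A o\<^sub>L op_power A n"

definition is_inverse_op :: "('a::complex_inner \<Rightarrow>\<^sub>L 'a) \<Rightarrow> ('a \<Rightarrow>\<^sub>L 'a) \<Rightarrow> bool" where
  "is_inverse_op A B \<longleftrightarrow> B \<in> bounded_ops \<and> A o\<^sub>L B = id_blinfun \<and> B o\<^sub>L A = id_blinfun"

definition inverse_op :: "('a::complex_inner \<Rightarrow>\<^sub>L 'a) \<Rightarrow> ('a \<Rightarrow>\<^sub>L 'a)" where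
  "inverse_op A = (THE B. is_inverse_op A B)"

definition positive_op :: "('a::complex_inner \<Rightarrow>\<^sub>L 'a) \<Rightarrow> bool" where
  "positive_op A \<longleftrightarrow> A \<in> bounded_ops \<and>
     (\<forall>x. cinner (blinfun_apply A x) x \<in> \<real> \<and> 0 \<le> Re (cinner (blinfun_apply A x) x))"

definition sqrt_op :: "('a::complex_inner \<Rightarrow>\<^sub>L 'a) \<Rightarrow> ('a \<Rightarrow>\<^sub>L 'a)" where
  "sqrt_op A = (THE B. positive_op B \<and> B o\<^sub>L B = A)"

lift_definition scalar_op :: "complex \<Rightarrow> ('a::complex_inner \<Rightarrow>\<^sub>L 'a)" is "\<lambda>c x. c *\<^sub>C x"
proof (rule bounded_linear_intro)
  fix c :: complex and x :: 'a
  show "norm (c *\<^sub>C x) \<le> norm x * cmod c"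
    by (simp add: norm_scaleC mult.commute)
qed (simp_all add: scaleC_add_right scaleR_scaleC scaleC_scaleC mult.commute)

definition spectrum_op :: "('a::complex_inner \<Rightarrow>\<^sub>L 'a) \<Rightarrow> complex set" where
  "spectrum_op A = {c. \<nexists>B. is_inverse_op (A - scalar_op c) B}"

definition spectral_radius_op :: "('a::complex_inner \<Rightarrow>\<^sub>L 'a) \<Rightarrow> real" where
  "spectral_radius_op A = (SUP c\<in>spectrum_op A. cmod c)"

definition majorizes :: "('a::complex_inner \<Rightarrow>\<^sub>L 'a) \<Rightarrow> ('a \<Rightarrow>\<^sub>L 'a) \<Rightarrow> bool" where
  "majorizes A B \<longleftrightarrow> (\<exists>M>0. \<forall>x. norm (blinfun_apply B x) \<le> M * norm (blinfun_apply A x))"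

text \<open>
  It is irrelevant whether \<open>n = 0\<close> is included: for \<open>n = 0\<close> any \<open>M \<ge> norm S\<close> works.
\<close>

definition deddens_algebra :: "('a::complex_inner \<Rightarrow>\<^sub>L 'a) \<Rightarrow> ('a \<Rightarrow>\<^sub>L 'a) set" where
  "deddens_algebra T = {S \<in> bounded_ops. \<exists>M>0. \<forall>n x.
     norm (blinfun_apply (op_power T n) (blinfun_apply S x))
       \<le> M * norm (blinfun_apply (op_power T n) x)}"

definition d_coeff :: "('a::complex_inner \<Rightarrow>\<^sub>L 'a) \<Rightarrow> nat \<Rightarrow> real" where
  "d_coeff T m = 1 / (1 / real m + spectral_radius_op T)"

definition R_op :: "('a::chilbert_space \<Rightarrow>\<^sub>L 'a) \<Rightarrow> nat \<Rightarrow> ('a \<Rightarrow>\<^sub>L 'a)" where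
  "R_op T m = sqrt_op
     (\<Sum>n. d_coeff T m ^ (2 * n) *\<^sub>R (op_power (adjoint_op T) n o\<^sub>L op_power T n))"

definition spectral_radius_algebra :: "('a::chilbert_space \<Rightarrow>\<^sub>L 'a) \<Rightarrow> ('a \<Rightarrow>\<^sub>L 'a) set" where
  "spectral_radius_algebra T = {S \<in> bounded_ops.
     bdd_above ((\<lambda>m. norm (R_op T m o\<^sub>L S o\<^sub>L inverse_op (R_op T m))) ` {1..})}"

definition eigenvector_op :: "('a::complex_inner \<Rightarrow>\<^sub>L 'a) \<Rightarrow> 'a \<Rightarrow> bool" where
  "eigenvector_op A v \<longleftrightarrow> v \<noteq> 0 \<and> (\<exists>c. blinfun_apply A v = c *\<^sub>C v)"

end

theory Submission
  imports Defs
begin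

text \<open>
  An operator majorized by \<open>x \<otimes> y\<close> vanishes on the orthogonal complement of \<open>y\<close>, so
  \<open>T = w \<otimes> y\<close> with \<open>w \<noteq> 0\<close>, and \<open>T\<^sup>n = \<langle>w, y\<rangle>\<^sup>n\<^sup>-\<^sup>1 T\<close> for \<open>n \<ge> 1\<close>. This settles the Deddens
  algebra. Since \<open>r(T) = |\<langle>w, y\<rangle>|\<close>, the series defining \<open>R\<^sub>m\<^sup>2\<close> is geometric and
  \<open>R\<^sub>m = I + r (y \<otimes> y)\<close>: it fixes the complement of \<open>y\<close> and scales \<open>y\<close> by
  \<open>b\<^sub>m = 1 + r \<parallel>y\<parallel>\<^sup>2\<close>, which tends to infinity. Conjugating by \<open>R\<^sub>m\<close> multiplies the block of \<open>S\<close>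
  mapping the complement of \<open>y\<close> to the span of \<open>y\<close> by \<open>b\<^sub>m\<close>, so the conjugates stay bounded iff this
  block is zero, that is, iff \<open>y\<close> is an eigenvector of \<open>S\<^sup>*\<close>.
\<close>

section \<open>Complex inner product spaces\<close>

lemma scaleC_zero_left [simp]: "0 *\<^sub>C x = 0" for x :: "'a::complex_inner"
  using scaleC_add_left[of 0 0 x] by simp

lemma scaleC_zero_right [simp]: "c *\<^sub>C 0 = (0 :: 'a::complex_inner)"
  using scaleC_add_right[of c "0::'a" 0] by simp

lemma scaleC_one [simp]: "1 *\<^sub>C x = x" for x :: "'a::complex_inner"
  using scaleR_scaleC[of 1 x] by simp

lemma scaleC_minus_left: "(- c) *\<^sub>C x = - (c *\<^sub>C x)" for x :: "'a::complex_inner"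
  using scaleC_add_left[of "- c" c x] by (simp add: eq_neg_iff_add_eq_0)

lemma scaleC_minus_right: "c *\<^sub>C (- x) = - (c *\<^sub>C x)" for x :: "'a::complex_inner"
  using scaleC_add_right[of c "- x" x] by (simp add: eq_neg_iff_add_eq_0)

lemma scaleC_diff_left: "(c - d) *\<^sub>C x = c *\<^sub>C x - d *\<^sub>C x" for x :: "'a::complex_inner"
  using scaleC_add_left[of c "- d" x] by (simp add: scaleC_minus_left)

lemma scaleC_diff_right: "c *\<^sub>C (x - y) = c *\<^sub>C x - c *\<^sub>C y" for x :: "'a::complex_inner"
  using scaleC_add_right[of c x "- y"] by (simp add: scaleC_minus_right)

lemma cinner_zero_left [simp]: "cinner 0 y = 0" for y :: "'a::complex_inner"
  using cinner_add_left[of 0 0 y] by simp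

lemma cinner_zero_right [simp]: "cinner y 0 = 0" for y :: "'a::complex_inner"
  using cinner_add_right[of y 0 0] by simp

lemma cinner_minus_left: "cinner (- x) y = - cinner x y" for y :: "'a::complex_inner"
  using cinner_add_left[of "- x" x y] by (simp add: eq_neg_iff_add_eq_0)

lemma cinner_minus_right: "cinner x (- y) = - cinner x y" for y :: "'a::complex_inner"
  using cinner_add_right[of x "- y" y] by (simp add: eq_neg_iff_add_eq_0)

lemma cinner_diff_left: "cinner (x - y) z = cinner x z - cinner y z" for z :: "'a::complex_inner"
  using cinner_add_left[of x "- y" z] by (simp add: cinner_minus_left)

lemma cinner_diff_right: "cinner z (x - y) = cinner z x - cinner z y" for z :: "'a::complex_inner"
  using cinner_add_right[of z x "- y"] by (simp add: cinner_minus_right)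

lemmas cinner_simps = cinner_add_left cinner_add_right cinner_diff_left cinner_diff_right
  cinner_minus_left cinner_minus_right cinner_scaleC_left cinner_scaleC_right

lemmas scaleC_simps = scaleC_add_left scaleC_add_right scaleC_diff_left scaleC_diff_right
  scaleC_minus_left scaleC_minus_right scaleC_scaleC

lemma cinner_self_eq_0_iff [simp]: "cinner x x = 0 \<longleftrightarrow> x = 0" for x :: "'a::complex_inner"
  by (simp add: cinner_self)

lemma cinner_eqI:
  fixes u v :: "'a::complex_inner"
  assumes "\<And>z. cinner z u = cinner z v"
  shows "u = v"
  using assms[of "u - v"] by (metis cinner_diff_right cinner_self_eq_0_iff right_minus_eq)

section \<open>Norm geometry, minimal elements and the Riesz representation\<close>

lemma norm_add_square:
  "(norm (x + y))\<^sup>2 = (norm x)\<^sup>2 + 2 * Re (cinner x y) + (norm y)\<^sup>2" for x :: "'a::complex_inner"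
proof -
  have "Re (cinner y x) = Re (cinner x y)"
    by (metis cinner_commute complex_cnj(1) cnj.sel(1))
  then have "Re (cinner (x + y) (x + y)) = (norm x)\<^sup>2 + 2 * Re (cinner x y) + (norm y)\<^sup>2"
    unfolding cinner_add_left cinner_add_right by (simp add: cinner_self)
  then show ?thesis by (simp add: cinner_self)
qed

lemma parallelogram_law:
  "(norm (x + y))\<^sup>2 + (norm (x - y))\<^sup>2 = 2 * (norm x)\<^sup>2 + 2 * (norm y)\<^sup>2" for x :: "'a::complex_inner"
  using norm_add_square[of x y] norm_add_square[of x "- y"] by (simp add: cinner_minus_right)

text \<open>If \<open>cinner u k\<close> were nonzero, moving from \<open>u\<close> along
  \<open>k\<close> to the point nearest the origin would lower the squared norm by |<u,k>|^2 /
  |k|^2.\<close>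

lemma orthogonal_if_norm_minimal:
  fixes u k :: "'a::complex_inner"
  assumes "\<And>c. norm u \<le> norm (u + c *\<^sub>C k)"
  shows "cinner k u = 0"
proof (cases "k = 0")
  case False
  define g where "g = cinner u k"
  define t where "t = 1 / (norm k)\<^sup>2"
  \<comment> \<open>This is the minimizing coefficient -<u,k> / |k|^2.\<close>
  define c where "c = complex_of_real (- t) * g"
  have t: "t > 0" "t * (norm k)\<^sup>2 = 1" using False by (simp_all add: t_def)
  have "(norm u)\<^sup>2 \<le> (norm (u + c *\<^sub>C k))\<^sup>2"
    using assms by (intro power_mono) auto
  also have "\<dots> = (norm u)\<^sup>2 + 2 * Re (cnj c * g) + (cmod c * norm k)\<^sup>2"
    by (simp add: norm_add_square cinner_scaleC_right norm_scaleC g_def)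
  also have "Re (cnj c * g) = - t * (cmod g)\<^sup>2"
  proof -
    have "cnj c * g = complex_of_real (- t * (cmod g)\<^sup>2)"
      using complex_norm_square[of g] by (simp add: c_def mult.commute)
    then show ?thesis by simp
  qed
  also have "(cmod c * norm k)\<^sup>2 = t * (t * (norm k)\<^sup>2) * (cmod g)\<^sup>2"
    using t(1) by (simp add: c_def norm_mult power_mult_distrib power2_eq_square)
  finally have "t * (cmod g)\<^sup>2 \<le> 0" using t by simp
  then have "g = 0" using t by (simp add: mult_le_0_iff)
  then show ?thesis using cinner_commute[of k u] by (simp add: g_def)
qed simp

text \<open>A minimizing sequence is Cauchy: by convexity midpoints have norm at least the infimum
  \<open>d\<close>, and the parallelogram law turns this into a bound on differences. Completeness
  and closedness then supply the minimizer.\<close>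

lemma norm_minimal_element_exists:
  fixes C :: "'a::chilbert_space set"
  assumes "closed C" "convex C" "C \<noteq> {}"
  obtains u where "u \<in> C" "\<And>v. v \<in> C \<Longrightarrow> norm u \<le> norm v"
proof -
  define d where "d = Inf (norm ` C)"
  have bdd: "bdd_below (norm ` C)" by (rule bdd_belowI[of _ 0]) auto
  have d_le: "d \<le> norm v" if "v \<in> C" for v
    unfolding d_def using that bdd by (intro cInf_lower) auto
  have d0: "d \<ge> 0" unfolding d_def using assms by (intro cInf_greatest) auto
  have "\<exists>v\<in>C. norm v < d + 1 / Suc n" for n
  proof -
    have "Inf (norm ` C) < d + 1 / Suc n" by (simp add: d_def)
    then show ?thesis using cInf_lessD[of "norm ` C"] assms(3) by auto
  qed
  then obtain s where s: "\<And>n. s n \<in> C" "\<And>n. norm (s n) < d + 1 / Suc n" by metis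
  have lim: "(\<lambda>n. norm (s n)) \<longlonglongrightarrow> d"
  proof (rule tendsto_sandwich)
    show "\<forall>\<^sub>F n in sequentially. d \<le> norm (s n)" using d_le s by simp
    show "\<forall>\<^sub>F n in sequentially. norm (s n) \<le> d + 1 / Suc n"
      using s(2) by (auto intro!: always_eventually less_imp_le)
    have "(\<lambda>n. d + 1 / Suc n) \<longlonglongrightarrow> d + 0"
      using lim_inverse_n'[THEN LIMSEQ_Suc] by (intro tendsto_intros) simp
    then show "(\<lambda>n. d + 1 / Suc n) \<longlonglongrightarrow> d" by simp
  qed simp
  have sq: "(\<lambda>n. (norm (s n))\<^sup>2) \<longlonglongrightarrow> d\<^sup>2" using lim by (rule tendsto_power)
  have dist: "(norm (s m - s n))\<^sup>2 \<le> 2 * ((norm (s m))\<^sup>2 - d\<^sup>2) + 2 * ((norm (s n))\<^sup>2 - d\<^sup>2)" for m n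
  proof -
    have "(1/2) *\<^sub>R s m + (1/2) *\<^sub>R s n \<in> C"
      using assms(2) s(1) by (intro convexD) auto
    from d_le[OF this] have "2 * d \<le> norm (s m + s n)"
      by (simp flip: scaleR_add_right)
    then have "(2 * d)\<^sup>2 \<le> (norm (s m + s n))\<^sup>2" using d0 by (intro power_mono) auto
    then show ?thesis using parallelogram_law[of "s m" "s n"] by (simp add: power_mult_distrib)
  qed
  have "Cauchy s"
  proof (rule metric_CauchyI)
    fix e :: real assume e: "e > 0"
    \<comment> \<open>Each of the two terms bounding the squared distance in \<open>dist\<close>
      then stays below \<open>e\<^sup>2 / 2\<close>.\<close>
    then have "\<forall>\<^sub>F n in sequentially. (norm (s n))\<^sup>2 < d\<^sup>2 + e\<^sup>2 / 4"
      using sq by (intro order_tendstoD(2)[OF sq]) simp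
    then obtain N where N: "\<And>n. n \<ge> N \<Longrightarrow> (norm (s n))\<^sup>2 < d\<^sup>2 + e\<^sup>2 / 4"
      by (auto simp: eventually_sequentially)
    have "dist (s m) (s n) < e" if "m \<ge> N" "n \<ge> N" for m n
    proof -
      have "(norm (s m - s n))\<^sup>2 < e\<^sup>2"
        using dist[of m n] N[OF that(1)] N[OF that(2)] by argo
      then show ?thesis using e by (simp add: dist_norm power2_less_imp_less)
    qed
    then show "\<exists>M. \<forall>m\<ge>M. \<forall>n\<ge>M. dist (s m) (s n) < e" by blast
  qed
  then obtain u where u: "s \<longlonglongrightarrow> u" using Cauchy_convergent convergent_def by blast
  have "u \<in> C" using closed_sequentially[OF assms(1)] s(1) u by blast
  moreover have "norm u = d" using LIMSEQ_unique[OF tendsto_norm[OF u] lim] .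
  ultimately show thesis using that d_le by auto
qed

text \<open>The element \<open>u\<close> of least norm in the affine hyperplane \<open>f = 1\<close>
  is orthogonal to the kernel of \<open>f\<close>, because adding kernel vectors does not leave the
  hyperplane. Rescaling \<open>u\<close> by 1 / |u|^2 gives the representing vector.\<close>

lemma Riesz_representation:
  fixes f :: "'a::chilbert_space \<Rightarrow> complex"
  assumes "bounded_linear f" and scaleC: "\<And>c z. f (c *\<^sub>C z) = c * f z"
  shows "\<exists>u. \<forall>z. f z = cinner z u"
proof (cases "\<forall>z. f z = 0")
  case True
  then show ?thesis by (intro exI[of _ 0]) simp
next
  case False
  interpret f: bounded_linear f by fact
  obtain z0 where z0: "f z0 \<noteq> 0" using False by blast
  let ?C = "f -` {1}"
  have "(1 / f z0) *\<^sub>C z0 \<in> ?C" using z0 by (simp add: scaleC)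
  then have "?C \<noteq> {}" by blast
  moreover have "closed ?C"
    using assms(1) by (intro continuous_closed_vimage) (auto intro: f.isCont)
  moreover have "convex ?C"
    by (auto simp: convex_def f.add f.scaleR simp flip: scaleR_add_left)
  ultimately obtain u where u: "f u = 1" "\<And>v. f v = 1 \<Longrightarrow> norm u \<le> norm v"
    using norm_minimal_element_exists[of ?C] by auto
  have orth: "cinner k u = 0" if "f k = 0" for k
    using u that by (intro orthogonal_if_norm_minimal) (simp add: f.add scaleC)
  have u0: "u \<noteq> 0" using u(1) f.zero by auto
  have "f z = cinner z ((1 / cinner u u) *\<^sub>C u)" for z
  proof -
    \<comment> \<open>Since \<open>f u = 1\<close>, subtracting \<open>f z\<close> times
      \<open>u\<close> from \<open>z\<close> lands in the kernel.\<close>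
    have "cinner (z - f z *\<^sub>C u) u = 0" by (rule orth) (simp add: f.diff scaleC u)
    then have "cinner z u = f z * cinner u u" by (simp add: cinner_simps)
    then show ?thesis using u0 by (simp add: cinner_scaleC_right cinner_self)
  qed
  then show ?thesis by blast
qed

section \<open>Bounded operators and adjoints\<close>

lemma bounded_opsD: "A \<in> bounded_ops \<Longrightarrow> blinfun_apply A (c *\<^sub>C z) = c *\<^sub>C blinfun_apply A z"
  by (simp add: bounded_ops_def)

lemma bounded_linear_cinner_left: "bounded_linear (\<lambda>z. cinner z u)" for u :: "'a::complex_inner"
proof (rule bounded_linear_intro)
  show "cmod (cinner z u) \<le> norm z * norm u" for z by (rule complex_Cauchy_Schwarz)
qed (simp_all add: cinner_add_left scaleR_scaleC cinner_scaleC_left scaleR_conv_of_real)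

text \<open>Evaluates the definite description in \<open>adjoint_op\<close>: the inner products
  against all vectors determine the values of the adjoint.\<close>

lemma adjoint_op_unique:
  fixes A :: "'a::chilbert_space \<Rightarrow>\<^sub>L 'a"
  assumes "B \<in> bounded_ops"
    and "\<And>x y. cinner (blinfun_apply A x) y = cinner x (blinfun_apply B y)"
  shows "adjoint_op A = B"
  unfolding adjoint_op_def
proof (rule the_equality)
  fix C assume C: "C \<in> bounded_ops \<and>
    (\<forall>x y. cinner (blinfun_apply A x) y = cinner x (blinfun_apply C y))"
  show "C = B"
    using C assms(2) by (intro blinfun_eqI cinner_eqI) metis
qed (use assms in blast)

text \<open>Riesz representation at each \<open>y\<close> yields the value \<open>g y\<close>.
  Linearity of \<open>g\<close> follows from uniqueness of representing vectors, and boundedness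
  from |g y|^2 = <A (g y), y> by cancelling one factor |g y|.\<close>

lemma adjoint_op_exists:
  fixes A :: "'a::chilbert_space \<Rightarrow>\<^sub>L 'a"
  assumes A: "A \<in> bounded_ops"
  obtains B where "B \<in> bounded_ops"
    "\<And>x y. cinner (blinfun_apply A x) y = cinner x (blinfun_apply B y)"
proof -
  have "\<exists>u. \<forall>x. cinner (blinfun_apply A x) y = cinner x u" for y
  proof (rule Riesz_representation)
    show "bounded_linear (\<lambda>x. cinner (blinfun_apply A x) y)"
      by (rule bounded_linear_compose[OF bounded_linear_cinner_left blinfun.bounded_linear_right])
  qed (simp add: bounded_opsD[OF A] cinner_scaleC_left)
  then obtain g where g: "\<And>x y. cinner (blinfun_apply A x) y = cinner x (g y)" by metis
  have g_scaleC: "g (c *\<^sub>C y) = c *\<^sub>C g y" for c y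
    by (rule cinner_eqI) (simp add: cinner_scaleC_right flip: g)
  have "bounded_linear g"
  proof (rule bounded_linear_intro)
    show "g (y + z) = g y + g z" for y z
      by (rule cinner_eqI) (simp add: cinner_add_right flip: g)
    show "g (r *\<^sub>R y) = r *\<^sub>R g y" for r y
      by (simp add: scaleR_scaleC g_scaleC)
    show "norm (g y) \<le> norm y * norm A" for y
    proof (cases "g y = 0")
      case False
      have "(norm (g y))\<^sup>2 = cmod (cinner (g y) (g y))"
        unfolding cinner_self norm_of_real by simp
      also have "\<dots> = cmod (cinner (blinfun_apply A (g y)) y)" by (simp add: g)
      also have "\<dots> \<le> norm (blinfun_apply A (g y)) * norm y" by (rule complex_Cauchy_Schwarz)
      also have "\<dots> \<le> norm A * norm (g y) * norm y"
        by (intro mult_right_mono norm_blinfun) simp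
      finally have "norm (g y) * norm (g y) \<le> norm (g y) * (norm y * norm A)"
        by (simp add: power2_eq_square mult_ac)
      then show ?thesis using False by simp
    qed simp
  qed
  then show thesis
    using that[of "Blinfun g"] g g_scaleC by (simp add: bounded_ops_def bounded_linear_Blinfun_apply)
qed

lemma cinner_adjoint_op:
  fixes A :: "'a::chilbert_space \<Rightarrow>\<^sub>L 'a"
  assumes "A \<in> bounded_ops"
  shows "cinner (blinfun_apply A x) y = cinner x (blinfun_apply (adjoint_op A) y)"
proof -
  obtain B where "B \<in> bounded_ops"
    "\<And>x y. cinner (blinfun_apply A x) y = cinner x (blinfun_apply B y)"
    using adjoint_op_exists[OF assms] by blast
  then show ?thesis using adjoint_op_unique by metis
qed

lemma inverse_op_unique: "is_inverse_op A B \<Longrightarrow> inverse_op A = B"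
  unfolding inverse_op_def
proof (rule the_equality)
  fix C assume "is_inverse_op A B" "is_inverse_op A C"
  then have "C o\<^sub>L (A o\<^sub>L B) = C" "(C o\<^sub>L A) o\<^sub>L B = B"
    by (auto simp: is_inverse_op_def intro: blinfun_eqI)
  moreover have "C o\<^sub>L (A o\<^sub>L B) = (C o\<^sub>L A) o\<^sub>L B" by (rule blinfun_eqI) simp
  ultimately show "C = B" by simp
qed

section \<open>Rank one operators\<close>

lemma rank_one_apply [simp]: "blinfun_apply (u \<otimes> v) z = cinner z v *\<^sub>C u"
  by transfer simp

lemma scalar_op_apply [simp]: "blinfun_apply (scalar_op c) z = c *\<^sub>C z"
  by transfer simp

lemma rank_one_bounded_ops [simp]: "u \<otimes> v \<in> bounded_ops"
  by (simp add: bounded_ops_def cinner_scaleC_left scaleC_scaleC)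

lemma adjoint_op_rank_one: "adjoint_op (u \<otimes> v) = v \<otimes> u" for u :: "'a::chilbert_space"
proof (rule adjoint_op_unique)
  show "cinner (blinfun_apply (u \<otimes> v) a) b = cinner a (blinfun_apply (v \<otimes> u) b)" for a b
    using cinner_commute[of u b] by (simp add: cinner_scaleC_left cinner_scaleC_right)
qed simp

lemma op_power_rank_one_Suc:
  "blinfun_apply (op_power (u \<otimes> v) (Suc n)) z = (cinner u v ^ n * cinner z v) *\<^sub>C u"
  by (induction n) (simp_all add: cinner_scaleC_left mult_ac)

text \<open>Majorization makes \<open>T\<close> vanish wherever \<open>x \<otimes> y\<close> does,
  in particular on the orthogonal complement of \<open>y\<close>. So \<open>T z\<close> depends only
  on the projection of \<open>z\<close> to the span of \<open>y\<close>.\<close>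

lemma rank_one_of_majorized:
  fixes x y :: "'a::complex_inner"
  assumes T: "T \<in> bounded_ops" and "majorizes (x \<otimes> y) T" and "y \<noteq> 0"
  shows "T = ((1 / cinner y y) *\<^sub>C blinfun_apply T y) \<otimes> y"
proof (rule blinfun_eqI)
  fix z
  obtain M where M: "\<And>z. norm (blinfun_apply T z) \<le> M * norm (blinfun_apply (x \<otimes> y) z)"
    using assms(2) by (auto simp: majorizes_def)
  define v where "v = z - (cinner z y / cinner y y) *\<^sub>C y"
  have "cinner v y = 0" using \<open>y \<noteq> 0\<close> by (simp add: v_def cinner_simps)
  then have "blinfun_apply T v = 0" using M[of v] by simp
  then show "blinfun_apply T z
      = blinfun_apply (((1 / cinner y y) *\<^sub>C blinfun_apply T y) \<otimes> y) z"
    by (simp add: v_def blinfun.diff_right bounded_opsD[OF T] scaleC_scaleC)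
qed

section \<open>Spectrum and spectral radius of rank one operators\<close>

lemma not_spectrum_opI: "is_inverse_op (A - scalar_op c) B \<Longrightarrow> c \<notin> spectrum_op A"
  by (auto simp: spectrum_op_def)

lemma eigenvalue_in_spectrum_op:
  assumes "blinfun_apply A v = c *\<^sub>C v" "v \<noteq> 0"
  shows "c \<in> spectrum_op A"
proof -
  have False if "is_inverse_op (A - scalar_op c) B" for B
  proof -
    have "v = blinfun_apply (B o\<^sub>L (A - scalar_op c)) v"
      using that by (simp add: is_inverse_op_def)
    also have "\<dots> = 0" using assms(1) by (simp add: blinfun.diff_left blinfun.zero_right)
    finally show False using assms(2) by simp
  qed
  then show ?thesis by (auto simp: spectrum_op_def)
qed

text \<open>The square of \<open>u \<otimes> v\<close> is \<open>cinner u v\<close> times itself, so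
  the resolvent can be sought as a combination of the identity and \<open>u \<otimes> v\<close>.
  Only an inclusion holds in general: in dimension one 0 may lie outside the spectrum.\<close>

lemma spectrum_op_rank_one_subset: "spectrum_op (u \<otimes> v) \<subseteq> {0, cinner u v}"
proof -
  have "c \<notin> spectrum_op (u \<otimes> v)" if c: "c \<noteq> 0" "c \<noteq> cinner u v" for c
  proof (rule not_spectrum_opI)
    define a where "a = cinner u v"
    define k where "k = 1 / (c * (a - c))"
    define B where "B = scalar_op (- (1 / c)) + (scalar_op k o\<^sub>L (u \<otimes> v))"
    \<comment> \<open>This identity makes the coefficient of \<open>u\<close> vanish in both
      products below.\<close>
    have k: "k * a - c * k = 1 / c"
    proof -
      have "k * a - c * k = k * (a - c)" by (simp add: algebra_simps)
      also have "\<dots> = 1 / c" using c by (simp add: k_def a_def)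
      finally show ?thesis .
    qed
    have B: "blinfun_apply B z = (- (1 / c)) *\<^sub>C z + (k * cinner z v) *\<^sub>C u" for z
      by (simp add: B_def blinfun.add_left scaleC_scaleC)
    have "B \<in> bounded_ops"
      by (simp add: bounded_ops_def B scaleC_simps cinner_scaleC_left mult_ac)
    moreover have "(u \<otimes> v - scalar_op c) o\<^sub>L B = id_blinfun"
    proof (rule blinfun_eqI)
      fix z
      have "blinfun_apply ((u \<otimes> v - scalar_op c) o\<^sub>L B) z
          = (cinner z v * ((k * a - c * k) - 1 / c)) *\<^sub>C u + z"
        using c by (simp add: B blinfun.diff_left cinner_simps scaleC_simps a_def algebra_simps)
      then show "blinfun_apply ((u \<otimes> v - scalar_op c) o\<^sub>L B) z = blinfun_apply id_blinfun z"
        by (simp add: k)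
    qed
    moreover have "B o\<^sub>L (u \<otimes> v - scalar_op c) = id_blinfun"
    proof (rule blinfun_eqI)
      fix z
      have "blinfun_apply (B o\<^sub>L (u \<otimes> v - scalar_op c)) z
          = (cinner z v * ((k * a - c * k) - 1 / c)) *\<^sub>C u + z"
        using c by (simp add: B blinfun.diff_left cinner_simps scaleC_simps a_def algebra_simps)
      then show "blinfun_apply (B o\<^sub>L (u \<otimes> v - scalar_op c)) z = blinfun_apply id_blinfun z"
        by (simp add: k)
    qed
    ultimately show "is_inverse_op (u \<otimes> v - scalar_op c) B" by (simp add: is_inverse_op_def)
  qed
  then show ?thesis by blast
qed

text \<open>The supremum is attained: \<open>u\<close> is an eigenvector for
  \<open>cinner u v\<close>, and the only other candidate in the spectrum is 0.\<close>

lemma spectral_radius_rank_one: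
  assumes "u \<noteq> 0"
  shows "spectral_radius_op (u \<otimes> v) = cmod (cinner u v)"
  unfolding spectral_radius_op_def
proof (rule cSup_eq_maximum)
  have "cinner u v \<in> spectrum_op (u \<otimes> v)"
    using assms by (intro eigenvalue_in_spectrum_op[of _ u]) simp_all
  then show "cmod (cinner u v) \<in> cmod ` spectrum_op (u \<otimes> v)" by blast
  show "r \<le> cmod (cinner u v)" if "r \<in> cmod ` spectrum_op (u \<otimes> v)" for r
    using that spectrum_op_rank_one_subset[of u v] by auto
qed

section \<open>Rank one perturbations of the identity\<close>

text \<open>These operators fix the complement of \<open>y\<close> and scale \<open>y\<close> by 1 +
  r |y|^2. The family is closed under composition, so products, inverses and square roots reduce to
  arithmetic of the parameter \<open>r\<close>.\<close>

definition id_plus_rank_one :: "real \<Rightarrow> 'a::complex_inner \<Rightarrow> ('a \<Rightarrow>\<^sub>L 'a)" where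
  "id_plus_rank_one r y = id_blinfun + r *\<^sub>R (y \<otimes> y)"

lemma id_plus_rank_one_apply:
  "blinfun_apply (id_plus_rank_one r y) z = z + (r * cinner z y) *\<^sub>C y"
  by (simp add: id_plus_rank_one_def blinfun.add_left blinfun.scaleR_left scaleR_scaleC scaleC_scaleC)

lemma id_plus_rank_one_bounded_ops: "id_plus_rank_one r y \<in> bounded_ops"
  by (simp add: bounded_ops_def id_plus_rank_one_apply scaleC_simps cinner_scaleC_left mult_ac)

lemma id_plus_rank_one_compose:
  "id_plus_rank_one r y o\<^sub>L id_plus_rank_one s y = id_plus_rank_one (r + s + r * s * (norm y)\<^sup>2) y"
  by (rule blinfun_eqI)
    (simp add: id_plus_rank_one_apply cinner_simps scaleC_simps cinner_self algebra_simps)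

lemma id_plus_rank_one_0: "id_plus_rank_one 0 y = id_blinfun"
  by (simp add: id_plus_rank_one_def)

text \<open>The parameter is chosen so that the scaling factor of \<open>y\<close> becomes the
  reciprocal 1 / (1 + r |y|^2); \<open>r \<ge> 0\<close> keeps the denominator positive.\<close>

lemma inverse_op_id_plus_rank_one:
  assumes "r \<ge> 0"
  shows "inverse_op (id_plus_rank_one r y) = id_plus_rank_one (- r / (1 + r * (norm y)\<^sup>2)) y"
proof (rule inverse_op_unique)
  define q where "q = 1 + r * (norm y)\<^sup>2"
  have "q > 0" using assms by (simp add: q_def add_pos_nonneg)
  then have "r + - r / q + r * (- r / q) * (norm y)\<^sup>2 = r * (q - (1 + r * (norm y)\<^sup>2)) / q"
    by (simp add: field_simps)
  then have "r + - r / q + r * (- r / q) * (norm y)\<^sup>2 = 0" by (simp add: q_def)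
  then show "is_inverse_op (id_plus_rank_one r y)
      (id_plus_rank_one (- r / (1 + r * (norm y)\<^sup>2)) y)"
    unfolding q_def[symmetric] is_inverse_op_def
    by (simp add: id_plus_rank_one_bounded_ops id_plus_rank_one_compose id_plus_rank_one_0
        algebra_simps)
qed

lemma positive_id_plus_rank_one:
  assumes "r \<ge> 0"
  shows "positive_op (id_plus_rank_one r y)"
proof -
  have "cinner (blinfun_apply (id_plus_rank_one r y) z) z
      = complex_of_real ((norm z)\<^sup>2 + r * (cmod (cinner z y))\<^sup>2)" for z
    using cinner_commute[of y z] complex_norm_square[of "cinner z y"]
    by (simp add: id_plus_rank_one_apply cinner_simps cinner_self mult.assoc)
  then show ?thesis
    using assms by (simp add: positive_op_def id_plus_rank_one_bounded_ops del: of_real_add of_real_mult)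
qed

text \<open>With \<open>u = B v - b v\<close> one has \<open>B u = - b u\<close>, which positivity of \<open>B\<close> forbids unless \<open>u = 0\<close>.\<close>

lemma positive_op_sqrt_eigenvector:
  fixes b :: real
  assumes B: "positive_op B" and "b > 0"
    and sq: "blinfun_apply B (blinfun_apply B v) = (b\<^sup>2) *\<^sub>R v"
  shows "blinfun_apply B v = b *\<^sub>R v"
proof -
  define u where "u = blinfun_apply B v - b *\<^sub>R v"
  have "blinfun_apply B u = (- b) *\<^sub>R u"
    by (simp add: u_def blinfun.diff_right blinfun.scaleR_right sq power2_eq_square algebra_simps)
  then have "cinner (blinfun_apply B u) u = complex_of_real (- b * (norm u)\<^sup>2)"
    by (simp add: scaleR_scaleC cinner_scaleC_left cinner_self scaleC_minus_left cinner_minus_left)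
  moreover have "0 \<le> Re (cinner (blinfun_apply B u) u)" using B by (simp add: positive_op_def)
  ultimately have "b * (norm u)\<^sup>2 \<le> 0" by simp
  then have "u = 0" using \<open>b > 0\<close> by (simp add: mult_le_0_iff)
  then show ?thesis by (simp add: u_def)
qed

text \<open>The parameter on the left comes from squaring 1 + r |y|^2. For uniqueness,
  \<open>y\<close> and the vectors orthogonal to it are eigenvectors of the square with positive
  eigenvalues, hence also of any positive root, which is thereby determined.\<close>

lemma sqrt_op_id_plus_rank_one:
  fixes y :: "'a::complex_inner"
  assumes "r \<ge> 0"
  shows "sqrt_op (id_plus_rank_one (r * (2 + r * (norm y)\<^sup>2)) y) = id_plus_rank_one r y"
  unfolding sqrt_op_def
proof (rule the_equality)
  show "positive_op (id_plus_rank_one r y) \<and> id_plus_rank_one r y o\<^sub>L id_plus_rank_one r y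
      = id_plus_rank_one (r * (2 + r * (norm y)\<^sup>2)) y"
    using positive_id_plus_rank_one[OF assms] by (simp add: id_plus_rank_one_compose algebra_simps)
next
  fix B assume B: "positive_op B \<and> B o\<^sub>L B = id_plus_rank_one (r * (2 + r * (norm y)\<^sup>2)) y"
  then have BB: "blinfun_apply B (blinfun_apply B z)
      = z + ((r * (2 + r * (norm y)\<^sup>2)) * cinner z y) *\<^sub>C y" for z
    by (metis blinfun_apply_blinfun_compose id_plus_rank_one_apply)
  show "B = id_plus_rank_one r y"
  proof (rule blinfun_eqI)
    fix z
    define v where "v = z - (cinner z y / cinner y y) *\<^sub>C y"
    \<comment> \<open>For \<open>y = 0\<close> the quotient in \<open>v\<close> is 0 by the
      convention for division, so \<open>v = z\<close>.\<close>
    have "cinner v y = 0" by (cases "y = 0") (simp_all add: v_def cinner_simps)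
    then have "blinfun_apply B v = 1 *\<^sub>R v"
      using B by (intro positive_op_sqrt_eigenvector) (simp_all add: BB)
    moreover have "blinfun_apply B y = (1 + r * (norm y)\<^sup>2) *\<^sub>R y"
    proof (rule positive_op_sqrt_eigenvector)
      show "1 + r * (norm y)\<^sup>2 > 0" using assms by (simp add: add_pos_nonneg)
      have "complex_of_real ((1 + r * (norm y)\<^sup>2)\<^sup>2)
          = 1 + (r * (2 + r * (norm y)\<^sup>2)) * cinner y y"
        by (simp add: cinner_self power2_eq_square algebra_simps)
      then show "blinfun_apply B (blinfun_apply B y) = ((1 + r * (norm y)\<^sup>2)\<^sup>2) *\<^sub>R y"
        unfolding BB scaleR_scaleC by (simp add: scaleC_add_left)
    qed (use B in blast)
    moreover have "B \<in> bounded_ops" using B by (simp add: positive_op_def)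
    moreover have z: "z = v + (cinner z y / cinner y y) *\<^sub>C y" by (simp add: v_def)
    ultimately have "blinfun_apply B z
        = v + (cinner z y / cinner y y * (1 + r * (norm y)\<^sup>2)) *\<^sub>C y"
      by (metis blinfun.add_right bounded_opsD scaleC_scaleC scaleR_one scaleR_scaleC)
    also have "\<dots> = z + (r * cinner z y) *\<^sub>C y"
      by (cases "y = 0")
        (simp_all add: v_def cinner_self distrib_left scaleC_add_left mult.commute)
    finally show "blinfun_apply B z = blinfun_apply (id_plus_rank_one r y) z"
      by (simp add: id_plus_rank_one_apply)
  qed
qed

section \<open>Spectral radius algebras of rank one operators\<close>

text \<open>For n at least 1, the product of the n-th powers of the adjoint and of
  \<open>w \<otimes> y\<close> is |<w,y>|^(2(n-1)) |w|^2 times \<open>y \<otimes> y\<close>. This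
  leaves a geometric series, while the term for n = 0 is the identity and is added
  separately.\<close>

lemma sums_power_rank_one:
  fixes w y :: "'a::chilbert_space"
  assumes d: "\<bar>d\<bar> * cmod (cinner w y) < 1"
  shows "(\<lambda>n. d ^ (2 * n) *\<^sub>R (op_power (adjoint_op (w \<otimes> y)) n o\<^sub>L op_power (w \<otimes> y) n)) sums
    id_plus_rank_one (d\<^sup>2 * (norm w)\<^sup>2 / (1 - (d * cmod (cinner w y))\<^sup>2)) y"
    (is "?f sums _")
proof -
  define a where "a = cmod (cinner w y)"
  have "(d * a)\<^sup>2 < 1"
    using d by (simp add: a_def abs_square_less_1 abs_mult)
  then have "(\<lambda>n. ((d * a)\<^sup>2) ^ n) sums (1 / (1 - (d * a)\<^sup>2))"
    by (intro geometric_sums) simp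
  then have "(\<lambda>n. d\<^sup>2 * (norm w)\<^sup>2 * ((d * a)\<^sup>2) ^ n) sums (d\<^sup>2 * (norm w)\<^sup>2 * (1 / (1 - (d * a)\<^sup>2)))"
    by (rule sums_mult)
  then have "(\<lambda>n. (d\<^sup>2 * (norm w)\<^sup>2 * ((d * a)\<^sup>2) ^ n) *\<^sub>R (y \<otimes> y)) sums
      ((d\<^sup>2 * (norm w)\<^sup>2 * (1 / (1 - (d * a)\<^sup>2))) *\<^sub>R (y \<otimes> y))"
    by (rule bounded_linear.sums[OF bounded_linear_scaleR_left])
  moreover have "?f (Suc n) = (d\<^sup>2 * (norm w)\<^sup>2 * ((d * a)\<^sup>2) ^ n) *\<^sub>R (y \<otimes> y)" for n
  proof (rule blinfun_eqI)
    fix z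
    \<comment> \<open>The two conjugate factors come from the powers of \<open>y \<otimes> w\<close>
      and of \<open>w \<otimes> y\<close>.\<close>
    have "complex_of_real (a\<^sup>2 ^ n) = (cinner w y * cinner y w) ^ n"
      using cinner_commute[of y w] complex_norm_square[of "cinner w y"] by (simp add: a_def)
    then have "cinner y w ^ n * (cinner w y ^ n * cinner z y * cinner w w)
        = complex_of_real (a\<^sup>2 ^ n * (norm w)\<^sup>2) * cinner z y"
      by (simp add: cinner_self power_mult_distrib mult_ac)
    moreover have "d ^ (2 * Suc n) * (a\<^sup>2 ^ n * (norm w)\<^sup>2) = d\<^sup>2 * (norm w)\<^sup>2 * ((d * a)\<^sup>2) ^ n"
      by (simp add: power_mult power_mult_distrib flip: power2_eq_square)
    ultimately have coeff: "complex_of_real (d ^ (2 * Suc n)) *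
        (cinner y w ^ n * (cinner w y ^ n * cinner z y * cinner w w))
        = complex_of_real (d\<^sup>2 * (norm w)\<^sup>2 * ((d * a)\<^sup>2) ^ n) * cinner z y"
      by (metis mult.assoc of_real_mult)
    show "blinfun_apply (?f (Suc n)) z
        = blinfun_apply ((d\<^sup>2 * (norm w)\<^sup>2 * ((d * a)\<^sup>2) ^ n) *\<^sub>R (y \<otimes> y)) z"
      unfolding adjoint_op_rank_one blinfun.scaleR_left blinfun_apply_blinfun_compose
        op_power_rank_one_Suc rank_one_apply scaleR_scaleC scaleC_scaleC cinner_scaleC_left coeff ..
  qed
  ultimately have "(\<lambda>n. ?f (Suc n)) sums
      ((d\<^sup>2 * (norm w)\<^sup>2 * (1 / (1 - (d * a)\<^sup>2))) *\<^sub>R (y \<otimes> y))" by simp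
  then have "?f sums ((d\<^sup>2 * (norm w)\<^sup>2 * (1 / (1 - (d * a)\<^sup>2))) *\<^sub>R (y \<otimes> y) + ?f 0)"
    by (rule sums_Suc)
  moreover have "?f 0 = id_blinfun"
    by (rule blinfun_eqI) simp
  ultimately show ?thesis
    by (simp add: id_plus_rank_one_def a_def add.commute)
qed

text \<open>With \<open>h\<close> = 1/m and \<open>a\<close> = |<w,y>|, the spectral radius, one has
  \<open>d * a < 1\<close>, so the series sums to the identity plus \<open>l\<close> times
  \<open>y \<otimes> y\<close>. The third conclusion records that the squared scaling factor of
  \<open>y\<close> grows at least linearly in \<open>m\<close>.\<close>

lemma R_op_rank_one:
  fixes w y :: "'a::chilbert_space"
  assumes "w \<noteq> 0" "y \<noteq> 0" "m \<ge> 1"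
  obtains r where "r \<ge> 0" "R_op (w \<otimes> y) m = id_plus_rank_one r y"
    "(1 + r * (norm y)\<^sup>2)\<^sup>2 \<ge> m * ((norm w)\<^sup>2 * (norm y)\<^sup>2 / (1 + 2 * cmod (cinner w y)))"
proof -
  define a where "a = cmod (cinner w y)"
  define h where "h = 1 / real m"
  define d where "d = d_coeff (w \<otimes> y) m"
  define l where "l = d\<^sup>2 * (norm w)\<^sup>2 / (1 - (d * a)\<^sup>2)"
  have a: "a \<ge> 0" by (simp add: a_def)
  have h: "0 < h" "h \<le> 1" using assms(3) by (simp_all add: h_def)
  have d: "d = 1 / (h + a)" "d > 0"
    using h a by (simp_all add: d_def d_coeff_def h_def a_def spectral_radius_rank_one[OF assms(1)]
        add_pos_nonneg)
  have "\<bar>d\<bar> * a = a / (h + a)" using d by simp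
  then have da: "\<bar>d\<bar> * a < 1" using h a by simp
  have l: "l = (norm w)\<^sup>2 / (h * (h + 2 * a))"
  proof -
    \<comment> \<open>The factor \<open>d\<^sup>2\<close> isolated here cancels against the
      numerator of \<open>l\<close>.\<close>
    have "1 - (d * a)\<^sup>2 = (h * (h + 2 * a)) * d\<^sup>2"
    proof -
      have "d * (h + a) = 1" using d(1) h a by simp
      then have "1 - (d * a)\<^sup>2 = (d * (h + a))\<^sup>2 - (d * a)\<^sup>2" by simp
      then show ?thesis by (simp add: power2_eq_square algebra_simps)
    qed
    then show ?thesis using d(2) by (simp add: l_def)
  qed
  have l0: "l \<ge> 0" using l h a by simp
  have l_ge: "l \<ge> m * ((norm w)\<^sup>2 / (1 + 2 * a))"
  proof -
    have "m * ((norm w)\<^sup>2 / (1 + 2 * a)) = (norm w)\<^sup>2 / (h * (1 + 2 * a))"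
      using assms(3) by (simp add: h_def)
    also have "\<dots> \<le> l"
      \<comment> \<open>Here \<open>h \<le> 1\<close>, that is \<open>m \<ge> 1\<close>, replaces
        \<open>h + 2 * a\<close> by the larger \<open>1 + 2 * a\<close>; the remaining
        \<open>1 / h\<close> is the linear growth.\<close>
      unfolding l using h a by (intro divide_left_mono mult_left_mono mult_pos_pos) auto
    finally show ?thesis .
  qed
  \<comment> \<open>\<open>b\<close> is the factor by which the square root must scale
    \<open>y\<close>, and \<open>r\<close> is the parameter realizing it.\<close>
  define b where "b = sqrt (1 + l * (norm y)\<^sup>2)"
  define r where "r = (b - 1) / (norm y)\<^sup>2"
  have b: "b \<ge> 1" "b\<^sup>2 = 1 + l * (norm y)\<^sup>2" using l0 by (simp_all add: b_def)
  have r0: "r \<ge> 0" using b by (simp add: r_def)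
  have rb: "1 + r * (norm y)\<^sup>2 = b" using assms(2) by (simp add: r_def)
  have "r * (2 + r * (norm y)\<^sup>2) = r * (1 + b)" by (simp flip: rb)
  also have "\<dots> = (b\<^sup>2 - 1) / (norm y)\<^sup>2" by (simp add: r_def power2_eq_square algebra_simps)
  also have "\<dots> = l" using b assms(2) by simp
  finally have rl: "l = r * (2 + r * (norm y)\<^sup>2)" ..
  have "R_op (w \<otimes> y) m = sqrt_op (id_plus_rank_one l y)"
    using sums_unique[OF sums_power_rank_one[of d w y]] da
    by (simp add: R_op_def d_def a_def l_def)
  then have R: "R_op (w \<otimes> y) m = id_plus_rank_one r y"
    unfolding rl sqrt_op_id_plus_rank_one[OF r0] .
  have "m * ((norm w)\<^sup>2 / (1 + 2 * a)) * (norm y)\<^sup>2 \<le> l * (norm y)\<^sup>2"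
    using l_ge by (intro mult_right_mono) auto
  then have "(1 + r * (norm y)\<^sup>2)\<^sup>2 \<ge> m * ((norm w)\<^sup>2 * (norm y)\<^sup>2 / (1 + 2 * a))"
    by (simp add: rb b)
  with that r0 R show thesis by (simp add: a_def)
qed

text \<open>The vector is \<open>z\<close> minus the image of \<open>z\<close> under the inverse of
  \<open>id_plus_rank_one r y\<close>, a contraction of the projection of \<open>z\<close> onto the
  span of \<open>y\<close>.\<close>

lemma norm_rank_one_apply_le:
  assumes "0 \<le> r"
  shows "norm ((complex_of_real (r / (1 + r * (norm y)\<^sup>2)) * cinner z y) *\<^sub>C y) \<le> norm z"
proof -
  have "r / (1 + r * (norm y)\<^sup>2) * (cmod (cinner z y) * norm y)
      \<le> r / (1 + r * (norm y)\<^sup>2) * (norm z * norm y * norm y)"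
    using assms by (intro mult_left_mono mult_right_mono complex_Cauchy_Schwarz) auto
  also have "\<dots> = (r * (norm y)\<^sup>2 / (1 + r * (norm y)\<^sup>2)) * norm z"
    by (simp add: power2_eq_square)
  also have "\<dots> \<le> 1 * norm z"
    using assms by (intro mult_right_mono) (auto simp: divide_le_eq_1 add_pos_nonneg)
  finally show ?thesis
    using assms by (simp add: norm_scaleC norm_mult mult_ac del: of_real_divide)
qed

text \<open>The bound is uniform in \<open>r\<close>. The hypothesis on \<open>S\<close> says that
  the adjoint maps \<open>y\<close> to a multiple of itself, so the large factor \<open>r\<close>
  only meets \<open>cinner u y\<close>, where the inverse has already compensated for it.\<close>

lemma norm_conjugate_id_plus_rank_one_le:
  fixes y :: "'a::complex_inner"
  assumes "r \<ge> 0" and S: "\<And>z. cinner (blinfun_apply S z) y = c * cinner z y"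
  shows "norm (id_plus_rank_one r y o\<^sub>L S o\<^sub>L inverse_op (id_plus_rank_one r y))
    \<le> 2 * norm S + cmod c"
proof (rule norm_blinfun_bound)
  fix z
  define k where "k = complex_of_real (r / (1 + r * (norm y)\<^sup>2)) * cinner z y"
  define u where "u = z - k *\<^sub>C y"
  have u: "blinfun_apply (inverse_op (id_plus_rank_one r y)) z = u"
    using assms(1)
    by (simp add: inverse_op_id_plus_rank_one id_plus_rank_one_apply u_def k_def scaleC_minus_left)
  have pos: "1 + r * (norm y)\<^sup>2 > 0" using assms(1) by (simp add: add_pos_nonneg)
  have k: "norm (k *\<^sub>C y) \<le> norm z" unfolding k_def by (rule norm_rank_one_apply_le[OF assms(1)])
  \<comment> \<open>The inverse divides the inner product with \<open>y\<close> by 1 + r |y|^2,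
    which is the denominator in \<open>k\<close>.\<close>
  have "r * cinner u y = k"
  proof -
    have "k * complex_of_real (1 + r * (norm y)\<^sup>2) = r * cinner z y"
      using pos unfolding k_def by (simp flip: of_real_add of_real_mult of_real_power of_real_divide)
    then show ?thesis by (simp add: u_def cinner_simps cinner_self algebra_simps)
  qed
  then have rc: "complex_of_real r * (c * cinner u y) = c * k" by (metis mult.left_commute)
  have "blinfun_apply (id_plus_rank_one r y o\<^sub>L S o\<^sub>L inverse_op (id_plus_rank_one r y)) z
      = blinfun_apply S u + c *\<^sub>C (k *\<^sub>C y)"
    unfolding blinfun_apply_blinfun_compose u id_plus_rank_one_apply S rc scaleC_scaleC ..
  moreover have "norm (blinfun_apply S u) \<le> norm S * (2 * norm z)"
  proof (rule order_trans[OF norm_blinfun mult_left_mono])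
    show "norm u \<le> 2 * norm z" using norm_triangle_ineq4[of z "k *\<^sub>C y"] k by (simp add: u_def)
  qed simp
  moreover have "norm (c *\<^sub>C (k *\<^sub>C y)) \<le> cmod c * norm z"
    unfolding norm_scaleC[of c] by (intro mult_left_mono k) simp
  ultimately show "norm (blinfun_apply (id_plus_rank_one r y o\<^sub>L S o\<^sub>L
      inverse_op (id_plus_rank_one r y)) z) \<le> (2 * norm S + cmod c) * norm z"
    using norm_triangle_ineq[of "blinfun_apply S u" "c *\<^sub>C (k *\<^sub>C y)"] by (simp add: algebra_simps)
qed simp

text \<open>The inverse fixes \<open>z\<close>, and the left factor multiplies the component of
  \<open>S z\<close> along \<open>y\<close> by 1 + r |y|^2. Bounded conjugates with growing factors
  therefore force that component to vanish.\<close>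

lemma cinner_conjugate_id_plus_rank_one:
  fixes y :: "'a::complex_inner"
  assumes "r \<ge> 0" "cinner z y = 0"
  shows "(1 + r * (norm y)\<^sup>2) * cmod (cinner (blinfun_apply S z) y)
    \<le> norm (id_plus_rank_one r y o\<^sub>L S o\<^sub>L inverse_op (id_plus_rank_one r y)) * norm z * norm y"
    (is "_ \<le> norm ?A * _ * _")
proof -
  have "blinfun_apply ?A z = blinfun_apply (id_plus_rank_one r y) (blinfun_apply S z)"
    using assms by (simp add: inverse_op_id_plus_rank_one id_plus_rank_one_apply)
  then have "cinner (blinfun_apply ?A z) y
      = complex_of_real (1 + r * (norm y)\<^sup>2) * cinner (blinfun_apply S z) y"
    by (simp add: id_plus_rank_one_apply cinner_simps cinner_self algebra_simps)
  then have "(1 + r * (norm y)\<^sup>2) * cmod (cinner (blinfun_apply S z) y)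
      = cmod (cinner (blinfun_apply ?A z) y)"
    using assms(1) by (simp add: norm_mult add_nonneg_nonneg del: of_real_add)
  also have "\<dots> \<le> norm (blinfun_apply ?A z) * norm y" by (rule complex_Cauchy_Schwarz)
  also have "\<dots> \<le> norm ?A * norm z * norm y" by (intro mult_right_mono norm_blinfun) simp
  finally show ?thesis .
qed

text \<open>The condition on the right is invariance of the orthogonal complement of
  \<open>y\<close> under \<open>S\<close>. Conversely, the component of the image of
  \<open>y\<close> under the adjoint that is orthogonal to \<open>y\<close> turns out to be
  orthogonal to itself.\<close>

lemma eigenvector_adjoint_op_iff:
  fixes y :: "'a::chilbert_space"
  assumes "S \<in> bounded_ops" "y \<noteq> 0"
  shows "eigenvector_op (adjoint_op S) y \<longleftrightarrow>
    (\<forall>z. cinner z y = 0 \<longrightarrow> cinner (blinfun_apply S z) y = 0)"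
proof
  assume "eigenvector_op (adjoint_op S) y"
  then show "\<forall>z. cinner z y = 0 \<longrightarrow> cinner (blinfun_apply S z) y = 0"
    by (auto simp: eigenvector_op_def cinner_adjoint_op[OF assms(1)] cinner_scaleC_right)
next
  assume *: "\<forall>z. cinner z y = 0 \<longrightarrow> cinner (blinfun_apply S z) y = 0"
  define v where "v = blinfun_apply (adjoint_op S) y"
  define c where "c = cinner v y / cinner y y"
  have "cinner (v - c *\<^sub>C y) y = 0" using assms(2) by (simp add: c_def cinner_simps)
  \<comment> \<open>The invariance is applied to \<open>v - c y\<close> itself, and the adjoint
    moves \<open>S\<close> over to \<open>y\<close>, producing \<open>v\<close>.\<close>
  then have "cinner (v - c *\<^sub>C y) v = 0" using * by (simp add: v_def cinner_adjoint_op[OF assms(1)])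
  with \<open>cinner (v - c *\<^sub>C y) y = 0\<close> have "cinner (v - c *\<^sub>C y) (v - c *\<^sub>C y) = 0"
    by (simp only: cinner_diff_right cinner_scaleC_right) simp
  then have "v = c *\<^sub>C y" by simp
  then show "eigenvector_op (adjoint_op S) y" using assms(2) by (auto simp: eigenvector_op_def v_def)
qed

text \<open>The right-hand side does not involve \<open>w\<close>; this is what identifies the
  algebras of \<open>T\<close> and of \<open>x \<otimes> y\<close>.\<close>

lemma spectral_radius_algebra_rank_one:
  fixes w y :: "'a::chilbert_space"
  assumes "w \<noteq> 0" "y \<noteq> 0"
  shows "spectral_radius_algebra (w \<otimes> y) = {S \<in> bounded_ops. eigenvector_op (adjoint_op S) y}"
proof -
  let ?A = "\<lambda>S m. R_op (w \<otimes> y) m o\<^sub>L S o\<^sub>L inverse_op (R_op (w \<otimes> y) m)"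
  have "bdd_above ((\<lambda>m. norm (?A S m)) ` {1..}) \<longleftrightarrow> eigenvector_op (adjoint_op S) y"
    if S: "S \<in> bounded_ops" for S
  proof
    assume "eigenvector_op (adjoint_op S) y"
    then obtain c where c: "blinfun_apply (adjoint_op S) y = c *\<^sub>C y"
      by (auto simp: eigenvector_op_def)
    have "norm (?A S m) \<le> 2 * norm S + cmod (cnj c)" if m: "m \<ge> 1" for m
    proof -
      obtain r where "r \<ge> 0" "R_op (w \<otimes> y) m = id_plus_rank_one r y"
        using R_op_rank_one[OF assms m] .
      then show ?thesis
        using norm_conjugate_id_plus_rank_one_le[of r S y "cnj c"]
        by (simp add: cinner_adjoint_op[OF S] c cinner_scaleC_right)
    qed
    then show "bdd_above ((\<lambda>m. norm (?A S m)) ` {1..})" by (intro bdd_aboveI) auto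
  next
    assume "bdd_above ((\<lambda>m. norm (?A S m)) ` {1..})"
    then obtain K where K: "\<And>m. m \<ge> 1 \<Longrightarrow> norm (?A S m) \<le> K" by (auto simp: bdd_above_def)
    show "eigenvector_op (adjoint_op S) y"
      unfolding eigenvector_adjoint_op_iff[OF S assms(2)]
    proof (intro allI impI)
      fix z assume z: "cinner z y = 0"
      define g where "g = cmod (cinner (blinfun_apply S z) y)"
      define C where "C = (norm w)\<^sup>2 * (norm y)\<^sup>2 / (1 + 2 * cmod (cinner w y))"
      have C: "C > 0" using assms by (simp add: C_def add_pos_nonneg)
      \<comment> \<open>The left side grows linearly in \<open>m\<close> while the right side is
        constant, so \<open>g\<close> must be 0.\<close>
      have le: "real m * (C * g\<^sup>2) \<le> (K * norm z * norm y)\<^sup>2" if m: "m \<ge> 1" for m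
      proof -
        obtain r where r: "r \<ge> 0" "R_op (w \<otimes> y) m = id_plus_rank_one r y"
          "(1 + r * (norm y)\<^sup>2)\<^sup>2 \<ge> m * C"
          using R_op_rank_one[OF assms m] unfolding C_def .
        have "(1 + r * (norm y)\<^sup>2) * g \<le> norm (?A S m) * norm z * norm y"
          unfolding g_def r(2) by (rule cinner_conjugate_id_plus_rank_one[OF r(1) z])
        also have "\<dots> \<le> K * norm z * norm y" by (intro mult_right_mono K m) auto
        finally have "((1 + r * (norm y)\<^sup>2) * g)\<^sup>2 \<le> (K * norm z * norm y)\<^sup>2"
          using r(1) by (intro power_mono) (auto simp: g_def)
        moreover have "(m * C) * g\<^sup>2 \<le> (1 + r * (norm y)\<^sup>2)\<^sup>2 * g\<^sup>2"
          using r(3) by (intro mult_right_mono) auto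
        ultimately show ?thesis by (simp add: power_mult_distrib mult.assoc)
      qed
      have "C * g\<^sup>2 \<le> 0"
      proof (rule ccontr)
        assume "\<not> C * g\<^sup>2 \<le> 0"
        then obtain m where m: "(K * norm z * norm y)\<^sup>2 < real m * (C * g\<^sup>2)"
          using reals_Archimedean3[of "C * g\<^sup>2"] by auto
        \<comment> \<open>The estimate \<open>le\<close> starts at \<open>m = 1\<close>; for
          \<open>m = 0\<close> the strict inequality would put a square below 0.\<close>
        then have "m \<noteq> 0" by (intro notI) (simp add: not_less)
        then show False using le[of m] m by simp
      qed
      then show "cinner (blinfun_apply S z) y = 0" using C by (simp add: mult_le_0_iff g_def)
    qed
  qed
  then show ?thesis by (auto simp: spectral_radius_algebra_def)
qed

section \<open>Deddens algebras of rank one operators\<close>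

text \<open>The exponent 1 gives the forward direction. Conversely, all powers from 1 on send
  \<open>z\<close> to a fixed multiple of \<open>cinner z y\<close> times \<open>w\<close>, so one
  constant serves them all.\<close>

lemma deddens_algebra_rank_one_iff:
  assumes "w \<noteq> 0" and S: "S \<in> bounded_ops"
  shows "S \<in> deddens_algebra (w \<otimes> y) \<longleftrightarrow>
    (\<exists>M>0. \<forall>z. cmod (cinner (blinfun_apply S z) y) \<le> M * cmod (cinner z y))"
proof
  assume "S \<in> deddens_algebra (w \<otimes> y)"
  then obtain M where M: "M > 0" "\<And>n z. norm (blinfun_apply (op_power (w \<otimes> y) n) (blinfun_apply S z))
       \<le> M * norm (blinfun_apply (op_power (w \<otimes> y) n) z)"
    by (auto simp: deddens_algebra_def)
  have "cmod (cinner (blinfun_apply S z) y) \<le> M * cmod (cinner z y)" for z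
  proof -
    have "cmod (cinner (blinfun_apply S z) y) * norm w \<le> M * cmod (cinner z y) * norm w"
      using M(2)[of "Suc 0" z] unfolding op_power_rank_one_Suc by (simp add: norm_scaleC)
    then show ?thesis using assms(1) by simp
  qed
  then show "\<exists>M>0. \<forall>z. cmod (cinner (blinfun_apply S z) y) \<le> M * cmod (cinner z y)"
    using M(1) by blast
next
  assume "\<exists>M>0. \<forall>z. cmod (cinner (blinfun_apply S z) y) \<le> M * cmod (cinner z y)"
  then obtain M where M: "M > 0" "\<And>z. cmod (cinner (blinfun_apply S z) y) \<le> M * cmod (cinner z y)"
    by blast
  \<comment> \<open>Adding \<open>norm S\<close> to the constant takes care of the exponent 0, where
    the power is the identity.\<close>
  have "norm (blinfun_apply (op_power (w \<otimes> y) n) (blinfun_apply S z))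
       \<le> (M + norm S) * norm (blinfun_apply (op_power (w \<otimes> y) n) z)" for n z
  proof (cases n)
    case 0
    have "norm (blinfun_apply S z) \<le> norm S * norm z" by (rule norm_blinfun)
    also have "\<dots> \<le> (M + norm S) * norm z" using M(1) by (intro mult_right_mono) auto
    finally show ?thesis using 0 by simp
  next
    case (Suc k)
    have "cmod (cinner (blinfun_apply S z) y) \<le> (M + norm S) * cmod (cinner z y)"
      using M(2)[of z] mult_right_mono[of M "M + norm S" "cmod (cinner z y)"] by simp
    then have "(cmod (cinner w y) ^ k * norm w) * cmod (cinner (blinfun_apply S z) y)
        \<le> (cmod (cinner w y) ^ k * norm w) * ((M + norm S) * cmod (cinner z y))"
      by (intro mult_left_mono) auto
    then show ?thesis
      unfolding Suc op_power_rank_one_Suc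
      by (simp add: norm_scaleC norm_mult norm_power mult_ac)
  qed
  moreover have "M + norm S > 0" using M(1) by (simp add: add_pos_nonneg)
  ultimately show "S \<in> deddens_algebra (w \<otimes> y)" using S by (auto simp: deddens_algebra_def)
qed

lemma majorizes_rank_one_iff:
  assumes "h \<noteq> 0"
  shows "majorizes (h \<otimes> y) (h \<otimes> v) \<longleftrightarrow> (\<exists>M>0. \<forall>z. cmod (cinner z v) \<le> M * cmod (cinner z y))"
proof -
  have "cmod s * norm h \<le> M * (cmod t * norm h) \<longleftrightarrow> cmod s \<le> M * cmod t" for s t M
    using assms by (simp flip: mult.assoc)
  then show ?thesis by (simp add: majorizes_def norm_scaleC)
qed

text \<open>With \<open>h = 0\<close> the majorization would hold for every \<open>S\<close>, so a
  nonzero \<open>h\<close> is demanded. For \<open>T = 0\<close> every \<open>R_op T m\<close> is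
  the identity and the spectral radius algebra is everything, whatever \<open>y\<close> is;
  \<open>T \<noteq> 0\<close> excludes this and forces \<open>x\<close> and \<open>y\<close> to be
  nonzero.\<close>

theorem theorem2p6:
  fixes x y :: "'a::chilbert_space" and T :: "'a \<Rightarrow>\<^sub>L 'a"
  assumes "T \<in> bounded_ops" and "T \<noteq> 0" and "majorizes (x \<otimes> y) T"
  shows "(\<forall>S\<in>bounded_ops.
            (S \<in> deddens_algebra T \<longleftrightarrow>
              (\<exists>h. h \<noteq> 0 \<and> majorizes (h \<otimes> y) (h \<otimes> blinfun_apply (adjoint_op S) y))) \<and>
            ((\<exists>h. h \<noteq> 0 \<and> majorizes (h \<otimes> y) (h \<otimes> blinfun_apply (adjoint_op S) y)) \<longleftrightarrow>
              (\<exists>M>0. \<forall>z. cmod (cinner z (blinfun_apply (adjoint_op S) y)) \<le> M * cmod (cinner z y)))) \<and>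
         spectral_radius_algebra T = {S \<in> bounded_ops. eigenvector_op (adjoint_op S) y} \<and>
         {S \<in> bounded_ops. eigenvector_op (adjoint_op S) y} = spectral_radius_algebra (x \<otimes> y)"
proof -
  have x: "x \<noteq> 0" and y: "y \<noteq> 0"
    using assms(2,3) by (auto simp: majorizes_def intro: blinfun_eqI)
  define w where "w = (1 / cinner y y) *\<^sub>C blinfun_apply T y"
  have T: "T = w \<otimes> y" unfolding w_def by (rule rank_one_of_majorized[OF assms(1,3) y])
  then have w: "w \<noteq> 0" using assms(2) by (auto intro: blinfun_eqI)
  have "S \<in> deddens_algebra T \<longleftrightarrow> (\<exists>M>0. \<forall>z.
      cmod (cinner z (blinfun_apply (adjoint_op S) y)) \<le> M * cmod (cinner z y))"
    if "S \<in> bounded_ops" for S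
    unfolding T deddens_algebra_rank_one_iff[OF w that] cinner_adjoint_op[OF that] ..
  moreover have "(\<exists>h. h \<noteq> 0 \<and> majorizes (h \<otimes> y) (h \<otimes> v)) \<longleftrightarrow>
      (\<exists>M>0. \<forall>z. cmod (cinner z v) \<le> M * cmod (cinner z y))" for v
    \<comment> \<open>The nonzero vector \<open>y\<close> itself serves as the witness
      \<open>h\<close>.\<close>
    using majorizes_rank_one_iff y by blast
  ultimately show ?thesis
    using spectral_radius_algebra_rank_one[OF w y] spectral_radius_algebra_rank_one[OF x y]
    unfolding T by simp
qed

end
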